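(* Let $T_1,\dots,T_n:\mathcal{H}\to2^{\mathcal{H}}$ be operators satisfying the operator assumptions in the context, and suppose that for some $l\in\{1,\dots,n\}$ the operator $T_l$ is strongly monotone with constant $\mu>0$. Consider the sequences generated by the projective splitting algorithm described in the context (including the error and stepsize conditions stated there). Let $z^*$ be the unique solution of $0\in\sum_{i=1}^nT_iz$ and fix $p^*=(z^*,w_1^*,\dots,w_{n-1}^* )\in\mathcal{S}$. If $\bar K=+\infty$, then $x_i^k\to z^*$ (strongly) for $i=1,\dots,n$ and $z^k\to z^*$ (strongly). If $\bar K<\infty$, then $x_i^{\bar K}=z^{\bar K+1}=z^*$ for $i=1,\dots,n$. Furthermore, for all $1\le k<\bar K$, $$\|x_{\rm avg}^k-z^*\|^2\le\frac{\xi_1\|p^1-p^*\|^2}{\underline\beta\,\xi_2\,\mu\,k},\qquad\text{where } x_{\rm avg}^k=\frac1k\sum_{t=1}^kx_l^t.$$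
   Context: **General notation.** $\mathcal{H}$ is a real Hilbert space with inner product $\langle\cdot,\cdot\rangle$ and norm $\|\cdot\|$; $n\ge1$ is an integer; sums over empty index sets are $0$. For maximal monotone $T$ and $\rho>0$, $\mathrm{prox}_{\rho T}=(I+\rho T)^{-1}$. $T$ is strongly monotone with constant $\mu>0$ if $\langle u-v,u'-v'\rangle\ge\mu\|u-v\|^2$ for all $u'\in Tu$, $v'\in Tv$. **Operator assumptions.** The set $\{1,\dots,n\}$ is the disjoint union of $\mathcal{I}_F$ and $\mathcal{I}_B$. All $T_i:\mathcal{H}\to2^{\mathcal{H}}$ are monotone; for $i\in\mathcal{I}_F$, $T_i$ is single-valued, defined on all of $\mathcal{H}$ and $L_i$-Lipschitz continuous; for $i\in\mathcal{I}_B$, $T_i$ is maximal monotone. The extended solution set $\mathcal{S}=\{(z,w_1,\dots,w_{n-1})\in\mathcal{H}^n: w_i\in T_iz\ (i=1,\dots,n-1),\ -\sum_{i=1}^{n-1}w_i\in T_nz\}$ is nonempty. **Norm on $\mathcal{H}^n$.** For a fixed $\gamma>0$ and $p=(z,w_1,\dots,w_{n-1})\in\mathcal{H}^n$, $\|p\|^2=\gamma\|z\|^2+\sum_{i=1}^{n-1}\|w_i\|^2$. **Algorithm (projective splitting).** Inputs: a starting point $p^1=(z^1,w_1^1,\dots,w_{n-1}^1)\in\mathcal{H}^n$; stepsizes $\rho_i^k>0$; relaxation parameters $\beta_k\in[\underline\beta,\overline\beta]$ with $0<\underline\beta\le\overline\beta<2$; errors $e_i^k\in\mathcal{H}$ for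 $i\in\mathcal{I}_B$. Write $w_n^k=-\sum_{i=1}^{n-1}w_i^k$ and $p^k=(z^k,w_1^k,\dots,w_{n-1}^k)$. For $k=1,2,\dots$: - for $i\in\mathcal{I}_B$: $a=z^k+\rho_i^kw_i^k+e_i^k$, $x_i^k=\mathrm{prox}_{\rho_i^kT_i}(a)$, $y_i^k=(\rho_i^k)^{-1}(a-x_i^k)$ (so $y_i^k\in T_ix_i^k$); - for $i\in\mathcal{I}_F$: $x_i^k=z^k-\rho_i^k(T_iz^k-w_i^k)$, $y_i^k=T_ix_i^k$; - $u_i^k=x_i^k-x_n^k$ ($i=1,\dots,n-1$), $v^k=\sum_{i=1}^ny_i^k$, $\pi_k=\sum_{i=1}^{n-1}\|u_i^k\|^2+\gamma^{-1}\|v^k\|^2$; - if $\pi_k>0$: $\alpha_k=\beta_k\varphi_k(p^k)/\pi_k$, where $\varphi_k(p^k)=\langle z^k,v^k\rangle+\sum_{i=1}^{n-1}\langle w_i^k,u_i^k\rangle-\sum_{i=1}^n\langle x_i^k,y_i^k\rangle$, and then $z^{k+1}=z^k-\gamma^{-1}\alpha_kv^k$, $w_i^{k+1}=w_i^k-\alpha_ku_i^k$ ($i=1,\dots,n-1$); - if $\pi_k=0$: terminate, returning $z^{k+1}=x_n^k$, $w_i^{k+1}=y_i^k$ ($i=1,\dots,n-1$). $\bar K$ denotes the iteration at which the algorithm terminates ($\bar K=\infty$ if it never does). **Error conditions.** For some $\sigma\in[0,1)$ and $\delta\ge0$, for all $1\le k\le\bar K$ and $i\in\mathcal{I}_B$: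 $\langle z^k-x_i^k,e_i^k\rangle\ge-\sigma\|z^k-x_i^k\|^2$; $\langle e_i^k,y_i^k-w_i^k\rangle\le\rho_i^k\sigma\|y_i^k-w_i^k\|^2$; $\|e_i^k\|^2\le\delta\|z^k-x_i^k\|^2$. **Stepsize conditions.** $\underline\rho:=\min_{i=1,\dots,n}\inf_{1\le k\le\bar K}\rho_i^k>0$; for $i\in\mathcal{I}_B$, $\overline\rho_i:=\sup_{1\le k\le\bar K}\rho_i^k<\infty$; for $i\in\mathcal{I}_F$, $\overline\rho_i:=\sup_{1\le k\le\bar K}\rho_i^k<1/L_i$. **Constants.** $\overline\rho=\max_{i\in\mathcal{I}_B}\overline\rho_i$ ($=0$ if $\mathcal{I}_B=\emptyset$), $\bar L=\max_{i\in\mathcal{I}_F}L_i$ ($=0$ if $\mathcal{I}_F=\emptyset$), and $$\xi_1=2n\left[1+2\gamma^{-1}\big(\bar L^2|\mathcal{I}_F|+\underline\rho^{-2}(1+\delta)\big)\right],\qquad \xi_2=\min\left\{(1-\sigma)\overline\rho^{-1},\ \min_{j\in\mathcal{I}_F}\{\overline\rho_j^{-1}-L_j\}\right\},$$ where the first term in the minimum defining $\xi_2$ is $+\infty$ if $\mathcal{I}_B=\emptyset$, and the second is $+\infty$ if $\mathcal{I}_F=\emptyset$. *)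

theory Defs
  imports "HOL-Analysis.Analysis" "HOL-Library.Set_Algebras"
begin

definition monotone_op :: "('a::real_inner \<Rightarrow> 'a set) \<Rightarrow> bool" where
  "monotone_op T \<longleftrightarrow> (\<forall>u v. \<forall>u'\<in>T u. \<forall>v'\<in>T v. 0 \<le> inner (u - v) (u' - v'))"

definition maximal_monotone_op :: "('a::real_inner \<Rightarrow> 'a set) \<Rightarrow> bool" where
  "maximal_monotone_op T \<longleftrightarrow>
     monotone_op T \<and> (\<forall>S. monotone_op S \<and> (\<forall>u. T u \<subseteq> S u) \<longrightarrow> S = T)"

definition strongly_monotone_op :: "real \<Rightarrow> ('a::real_inner \<Rightarrow> 'a set) \<Rightarrow> bool" where
  "strongly_monotone_op \<mu> T \<longleftrightarrow>
     (\<forall>u v. \<forall>u'\<in>T u. \<forall>v'\<in>T v. \<mu> * (norm (u - v))\<^sup>2 \<le> inner (u - v) (u' - v'))"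

text \<open>The inverse of \<open>I + \<rho> T\<close> as a set-valued map. It has at most one value at each point
  when \<open>T\<close> is monotone and \<open>\<rho> > 0\<close>, and on a Hilbert space exactly one when \<open>T\<close> is maximal monotone, so
  \<open>x \<in> prox \<rho> T a\<close> expresses that \<open>x\<close> is the resolvent point of \<open>a\<close>.\<close>

definition prox :: "real \<Rightarrow> ('a::real_inner \<Rightarrow> 'a set) \<Rightarrow> 'a \<Rightarrow> 'a set" where
  "prox \<rho> T a = {x. \<exists>y\<in>T x. x + \<rho> *\<^sub>R y = a}"

text \<open>A point \<open>(z, w\<^sub>1, \<dots>, w\<^bsub>n-1\<^esub>)\<close> of the \<open>n\<close>-fold product is a pair \<open>(z, w)\<close>
  with \<open>w :: nat \<Rightarrow> 'a\<close>; only the values \<open>w i\<close> with \<open>1 \<le> i < n\<close> are ever used.\<close>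

definition extended_solution_set ::
  "nat \<Rightarrow> (nat \<Rightarrow> 'a::real_inner \<Rightarrow> 'a set) \<Rightarrow> ('a \<times> (nat \<Rightarrow> 'a)) set" where
  "extended_solution_set n T =
     {(z, w). (\<forall>i\<in>{1..<n}. w i \<in> T i z) \<and> - (\<Sum>i=1..<n. w i) \<in> T n z}"

definition prod_norm_sq :: "nat \<Rightarrow> real \<Rightarrow> 'a::real_inner \<times> (nat \<Rightarrow> 'a) \<Rightarrow> real" where
  "prod_norm_sq n \<gamma> = (\<lambda>(z, w). \<gamma> * (norm z)\<^sup>2 + (\<Sum>i=1..<n. (norm (w i))\<^sup>2))"

definition operator_assumptions ::
  "nat \<Rightarrow> nat set \<Rightarrow> nat set \<Rightarrow> (nat \<Rightarrow> real) \<Rightarrow> (nat \<Rightarrow> 'a::real_inner \<Rightarrow> 'a set) \<Rightarrow> bool" where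
  "operator_assumptions n IF IB L T \<longleftrightarrow>
     IF \<union> IB = {1..n} \<and> IF \<inter> IB = {} \<and>
     (\<forall>i\<in>{1..n}. monotone_op (T i)) \<and>
     (\<forall>i\<in>IF. (\<forall>z. is_singleton (T i z)) \<and> (L i)-lipschitz_on UNIV (\<lambda>z. the_elem (T i z))) \<and>
     (\<forall>i\<in>IB. maximal_monotone_op (T i)) \<and>
     extended_solution_set n T \<noteq> {}"

text \<open>All iterates carry the iteration counter \<open>k \<ge> 1\<close> first and the operator index second:
  \<open>x k i\<close>, \<open>y k i\<close>, \<open>w k i\<close>, \<open>\<rho> k i\<close>, \<open>e k i\<close>.\<close>

definition ext_w :: "nat \<Rightarrow> (nat \<Rightarrow> 'a::real_inner) \<Rightarrow> nat \<Rightarrow> 'a" where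
  "ext_w n w i = (if i = n then - (\<Sum>j=1..<n. w j) else w i)"

definition ps_u :: "nat \<Rightarrow> (nat \<Rightarrow> 'a::real_inner) \<Rightarrow> nat \<Rightarrow> 'a" where
  "ps_u n x i = x i - x n"

definition ps_v :: "nat \<Rightarrow> (nat \<Rightarrow> 'a::real_inner) \<Rightarrow> 'a" where
  "ps_v n y = (\<Sum>i=1..n. y i)"

definition ps_pi :: "nat \<Rightarrow> real \<Rightarrow> (nat \<Rightarrow> 'a::real_inner) \<Rightarrow> (nat \<Rightarrow> 'a) \<Rightarrow> real" where
  "ps_pi n \<gamma> x y = (\<Sum>i=1..<n. (norm (ps_u n x i))\<^sup>2) + inverse \<gamma> * (norm (ps_v n y))\<^sup>2"

definition ps_phi ::
  "nat \<Rightarrow> (nat \<Rightarrow> 'a::real_inner) \<Rightarrow> (nat \<Rightarrow> 'a) \<Rightarrow> 'a \<times> (nat \<Rightarrow> 'a) \<Rightarrow> real" where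
  "ps_phi n x y = (\<lambda>(z, w). inner z (ps_v n y) + (\<Sum>i=1..<n. inner (w i) (ps_u n x i))
                             - (\<Sum>i=1..n. inner (x i) (y i)))"

text \<open>The terminating iteration is the first \<open>k \<ge> 1\<close> with vanishing \<open>\<pi>\<^sub>k\<close>; the infimum of
  the empty set is \<open>\<infinity>\<close>. Iterates beyond it are arbitrary, apart from the returned point,
  stored at the successor index.\<close>

definition term_iter ::
  "nat \<Rightarrow> real \<Rightarrow> (nat \<Rightarrow> nat \<Rightarrow> 'a::real_inner) \<Rightarrow> (nat \<Rightarrow> nat \<Rightarrow> 'a) \<Rightarrow> enat" where
  "term_iter n \<gamma> x y = (INF k\<in>{k. 1 \<le> k \<and> ps_pi n \<gamma> (x k) (y k) = 0}. enat k)"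

definition iters :: "enat \<Rightarrow> nat set" where
  "iters K = {k. 1 \<le> k \<and> enat k \<le> K}"

definition proj_splitting_run ::
  "nat \<Rightarrow> real \<Rightarrow> nat set \<Rightarrow> nat set \<Rightarrow> (nat \<Rightarrow> 'a::real_inner \<Rightarrow> 'a set) \<Rightarrow>
   (nat \<Rightarrow> nat \<Rightarrow> real) \<Rightarrow> (nat \<Rightarrow> real) \<Rightarrow> (nat \<Rightarrow> nat \<Rightarrow> 'a) \<Rightarrow>
   (nat \<Rightarrow> 'a) \<Rightarrow> (nat \<Rightarrow> nat \<Rightarrow> 'a) \<Rightarrow> (nat \<Rightarrow> nat \<Rightarrow> 'a) \<Rightarrow> (nat \<Rightarrow> nat \<Rightarrow> 'a) \<Rightarrow> bool" where
  "proj_splitting_run n \<gamma> IF IB T \<rho> \<beta> e z w x y \<longleftrightarrow>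
     (\<forall>k\<in>iters (term_iter n \<gamma> x y).
        (\<forall>i\<in>IB. let a = z k + \<rho> k i *\<^sub>R ext_w n (w k) i + e k i in
                  x k i \<in> prox (\<rho> k i) (T i) a \<and>
                  y k i = inverse (\<rho> k i) *\<^sub>R (a - x k i)) \<and>
        (\<forall>i\<in>IF. x k i = z k - \<rho> k i *\<^sub>R (the_elem (T i (z k)) - ext_w n (w k) i) \<and>
                 y k i = the_elem (T i (x k i))) \<and>
        (if ps_pi n \<gamma> (x k) (y k) > 0
         then let \<alpha> = \<beta> k * ps_phi n (x k) (y k) (z k, w k) / ps_pi n \<gamma> (x k) (y k) in
                z (Suc k) = z k - (inverse \<gamma> * \<alpha>) *\<^sub>R ps_v n (y k) \<and>
                (\<forall>i\<in>{1..<n}. w (Suc k) i = w k i - \<alpha> *\<^sub>R ps_u n (x k) i)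
         else z (Suc k) = x k n \<and> (\<forall>i\<in>{1..<n}. w (Suc k) i = y k i)))"

definition error_conditions ::
  "real \<Rightarrow> real \<Rightarrow> nat set \<Rightarrow> enat \<Rightarrow> (nat \<Rightarrow> nat \<Rightarrow> real) \<Rightarrow> nat \<Rightarrow> (nat \<Rightarrow> nat \<Rightarrow> 'a::real_inner) \<Rightarrow>
   (nat \<Rightarrow> 'a) \<Rightarrow> (nat \<Rightarrow> nat \<Rightarrow> 'a) \<Rightarrow> (nat \<Rightarrow> nat \<Rightarrow> 'a) \<Rightarrow> (nat \<Rightarrow> nat \<Rightarrow> 'a) \<Rightarrow> bool" where
  "error_conditions \<sigma> \<delta> IB K \<rho> n e z w x y \<longleftrightarrow>
     (\<forall>k\<in>iters K. \<forall>i\<in>IB.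
        inner (z k - x k i) (e k i) \<ge> - \<sigma> * (norm (z k - x k i))\<^sup>2 \<and>
        inner (e k i) (y k i - ext_w n (w k) i)
          \<le> \<rho> k i * \<sigma> * (norm (y k i - ext_w n (w k) i))\<^sup>2 \<and>
        (norm (e k i))\<^sup>2 \<le> \<delta> * (norm (z k - x k i))\<^sup>2)"

definition rho_low :: "nat \<Rightarrow> enat \<Rightarrow> (nat \<Rightarrow> nat \<Rightarrow> real) \<Rightarrow> real" where
  "rho_low n K \<rho> = (MIN i\<in>{1..n}. INF k\<in>iters K. \<rho> k i)"

definition rho_up :: "enat \<Rightarrow> (nat \<Rightarrow> nat \<Rightarrow> real) \<Rightarrow> nat \<Rightarrow> ereal" where
  "rho_up K \<rho> i = (SUP k\<in>iters K. ereal (\<rho> k i))"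

text \<open>The quotient \<open>1 / L i\<close> is taken in the extended reals, so that it is \<open>\<infinity>\<close> if
  \<open>L i = 0\<close>.\<close>

definition stepsize_conditions ::
  "nat \<Rightarrow> nat set \<Rightarrow> nat set \<Rightarrow> (nat \<Rightarrow> real) \<Rightarrow> enat \<Rightarrow> (nat \<Rightarrow> nat \<Rightarrow> real) \<Rightarrow> bool" where
  "stepsize_conditions n IF IB L K \<rho> \<longleftrightarrow>
     rho_low n K \<rho> > 0 \<and>
     (\<forall>i\<in>IB. rho_up K \<rho> i < \<infinity>) \<and>
     (\<forall>i\<in>IF. rho_up K \<rho> i < 1 / ereal (L i))"

definition rho_bar :: "nat set \<Rightarrow> enat \<Rightarrow> (nat \<Rightarrow> nat \<Rightarrow> real) \<Rightarrow> real" where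
  "rho_bar IB K \<rho> = (if IB = {} then 0 else (MAX i\<in>IB. real_of_ereal (rho_up K \<rho> i)))"

definition L_bar :: "nat set \<Rightarrow> (nat \<Rightarrow> real) \<Rightarrow> real" where
  "L_bar IF L = (if IF = {} then 0 else (MAX i\<in>IF. L i))"

definition xi1 ::
  "nat \<Rightarrow> real \<Rightarrow> nat set \<Rightarrow> (nat \<Rightarrow> real) \<Rightarrow> real \<Rightarrow> enat \<Rightarrow> (nat \<Rightarrow> nat \<Rightarrow> real) \<Rightarrow> real" where
  "xi1 n \<gamma> IF L \<delta> K \<rho> =
     2 * real n * (1 + 2 * inverse \<gamma> *
       ((L_bar IF L)\<^sup>2 * real (card IF) + inverse ((rho_low n K \<rho>)\<^sup>2) * (1 + \<delta>)))"

text \<open>A term that is \<open>+\<infinity>\<close> by convention (for empty \<open>IB\<close> or \<open>IF\<close>) is left out of the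
  minimum. The set is nonempty, as \<open>IF \<union> IB = {1..n}\<close> with \<open>n \<ge> 1\<close>.\<close>

definition xi2 ::
  "nat set \<Rightarrow> nat set \<Rightarrow> (nat \<Rightarrow> real) \<Rightarrow> real \<Rightarrow> enat \<Rightarrow> (nat \<Rightarrow> nat \<Rightarrow> real) \<Rightarrow> real" where
  "xi2 IF IB L \<sigma> K \<rho> =
     Min ((if IB = {} then {} else {(1 - \<sigma>) * inverse (rho_bar IB K \<rho>)}) \<union>
          (\<lambda>j. inverse (real_of_ereal (rho_up K \<rho> j)) - L j) ` IF)"

end

theory Submission
  imports Defs
begin

text \<open>The affine function \<open>\<phi>\<^sub>k(z, w) = \<Sum>\<^sub>i \<langle>z - x\<^sub>i, y\<^sub>i - w\<^sub>i\<rangle>\<close> satisfies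
  \<open>\<phi>\<^sub>k(p\<^sup>k) \<ge> \<xi>\<^sub>2 s\<^sub>k\<close> and \<open>\<pi>\<^sub>k \<le> \<xi>\<^sub>1 s\<^sub>k\<close> with \<open>s\<^sub>k = \<Sum>\<^sub>i \<parallel>z\<^sup>k - x\<^sub>i\<^sup>k\<parallel>\<^sup>2\<close>, so that
  \<open>\<alpha>\<^sub>k \<ge> \<beta>lo \<xi>\<^sub>2 / \<xi>\<^sub>1\<close>, while strong monotonicity gives \<open>\<phi>\<^sub>k(p\<^sup>*) \<le> - \<mu> \<parallel>x\<^sub>l\<^sup>k - z\<^sup>*\<parallel>\<^sup>2\<close>.
  The relaxed projection onto the half-space \<open>\<phi>\<^sub>k \<le> 0\<close> therefore decreases the squared distance
  to \<open>p\<^sup>*\<close> by at least a fixed multiple of \<open>s\<^sub>k\<close> plus a fixed multiple of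
  \<open>\<parallel>x\<^sub>l\<^sup>k - z\<^sup>*\<parallel>\<^sup>2\<close>. Summing up yields the strong convergence and, with Jensen's
  inequality, the ergodic rate. If \<open>\<pi>\<^sub>k = 0\<close> then \<open>\<phi>\<^sub>k\<close> is constant, and comparing its values at
  \<open>p\<^sup>k\<close> and \<open>p\<^sup>*\<close> forces \<open>s\<^sub>k = 0\<close> and \<open>x\<^sub>l\<^sup>k = z\<^sup>*\<close>.\<close>

section \<open>Elementary inequalities for norms and sums\<close>

lemma norm_sum_sq_le:
  fixes f :: "'b \<Rightarrow> 'a::real_normed_vector"
  shows "(norm (\<Sum>i\<in>A. f i))\<^sup>2 \<le> real (card A) * (\<Sum>i\<in>A. (norm (f i))\<^sup>2)"
proof -
  have "(norm (\<Sum>i\<in>A. f i))\<^sup>2 \<le> (\<Sum>i\<in>A. norm (f i))\<^sup>2"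
    by (intro power_mono norm_sum) auto
  also have "\<dots> \<le> (\<Sum>i\<in>A. (norm (f i))\<^sup>2) * real (card A)"
    by (rule sum_squared_le_sum_of_squares)
  finally show ?thesis by (simp add: mult.commute)
qed

lemma norm_add_sq_le:
  fixes a b :: "'a::real_inner"
  shows "(norm (a + b))\<^sup>2 \<le> 2 * (norm a)\<^sup>2 + 2 * (norm b)\<^sup>2"
proof -
  have "0 \<le> (norm (a - b))\<^sup>2" by simp
  then show ?thesis
    by (simp add: power2_norm_eq_inner algebra_simps inner_commute)
qed

lemma sum_split_last:
  fixes f :: "nat \<Rightarrow> 'b::comm_monoid_add"
  assumes "n \<ge> 1"
  shows "(\<Sum>i=1..n. f i) = (\<Sum>i=1..<n. f i) + f n"
proof -
  have "{1..n} = insert n {1..<n}" using assms by auto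
  then show ?thesis by (simp add: add.commute)
qed

section \<open>Algebra of the affine function \<open>ps_phi\<close> and of its gradient\<close>

lemma sum_ext_w:
  assumes "n \<ge> 1"
  shows "(\<Sum>i=1..n. ext_w n w i) = 0"
  unfolding sum_split_last[OF assms] by (simp add: ext_w_def)

text \<open>Writing the last dual variable as minus the sum of the others pairs each
  \<open>w i\<close> with \<open>- x n\<close> as well as with \<open>x i\<close>; this is the
  origin of the differences \<open>ps_u\<close>.\<close>

lemma sum_inner_ext_w:
  assumes "n \<ge> 1"
  shows "(\<Sum>i=1..n. inner (x i) (ext_w n w i)) = (\<Sum>i=1..<n. inner (w i) (ps_u n x i))"
  unfolding sum_split_last[OF assms]
  by (simp add: ext_w_def ps_u_def inner_sum_right inner_diff_right sum_subtractf inner_commute)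

text \<open>The cross terms with \<open>z\<close> drop out because the extended dual variables sum
  to zero. In this symmetric form, with one summand per operator, \<open>ps_phi\<close> can be
  estimated termwise, both at the iterate and at a solution.\<close>

lemma ps_phi_eq_sum:
  assumes "n \<ge> 1"
  shows "ps_phi n x y (z, w) = (\<Sum>i=1..n. inner (z - x i) (y i - ext_w n w i))"
proof -
  have "(\<Sum>i=1..n. inner (z - x i) (y i - ext_w n w i))
      = inner z (ps_v n y) - inner z (\<Sum>i=1..n. ext_w n w i)
        - (\<Sum>i=1..n. inner (x i) (y i)) + (\<Sum>i=1..n. inner (x i) (ext_w n w i))"
    by (simp add: ps_v_def inner_sum_right inner_diff_left inner_diff_right sum_subtractf
        sum.distrib algebra_simps)
  then show ?thesis
    by (simp only: sum_ext_w[OF assms] sum_inner_ext_w[OF assms]) (simp add: ps_phi_def)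
qed

lemma extended_solution_ext_w:
  assumes "(z, w) \<in> extended_solution_set n T" and "i \<in> {1..n}"
  shows "ext_w n w i \<in> T i z"
  using assms by (auto simp: extended_solution_set_def ext_w_def)

lemma prod_norm_sq_diff:
  "prod_norm_sq n \<gamma> ((z, w) - (z', w'))
     = \<gamma> * (norm (z - z'))\<^sup>2 + (\<Sum>i=1..<n. (norm (w i - w' i))\<^sup>2)"
  by (simp add: prod_norm_sq_def)

text \<open>Makes the affinity of \<open>ps_phi\<close> explicit: its linear part is given by
  \<open>ps_v\<close> and the \<open>ps_u\<close>.\<close>

lemma ps_phi_diff:
  "ps_phi n x y (z, w) - ps_phi n x y (z', w')
     = inner (z - z') (ps_v n y) + (\<Sum>i=1..<n. inner (w i - w' i) (ps_u n x i))"
  by (simp add: ps_phi_def inner_diff_left sum_subtractf)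

text \<open>The update moves against the gradient of \<open>ps_phi\<close>. In the metric weighted
  by \<gamma> this gradient is \<open>(inverse \<gamma> * v, u)\<close>, with squared norm
  \<open>ps_pi\<close>; expanding the square turns the cross term into a difference of values of
  \<open>ps_phi\<close>.\<close>

lemma projection_step:
  assumes "\<gamma> > 0"
    and z': "z' = z - (inverse \<gamma> * \<alpha>) *\<^sub>R ps_v n y"
    and w': "\<And>i. i \<in> {1..<n} \<Longrightarrow> w' i = w i - \<alpha> *\<^sub>R ps_u n x i"
  shows "prod_norm_sq n \<gamma> ((z', w') - (zs, ws))
      = prod_norm_sq n \<gamma> ((z, w) - (zs, ws))
        - 2 * \<alpha> * (ps_phi n x y (z, w) - ps_phi n x y (zs, ws)) + \<alpha>\<^sup>2 * ps_pi n \<gamma> x y"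
proof -
  have sq: "(norm (a - c *\<^sub>R b))\<^sup>2 = (norm a)\<^sup>2 - 2 * c * inner a b + c\<^sup>2 * (norm b)\<^sup>2" for a b :: 'a and c
    unfolding power2_norm_eq_inner
    by (simp add: inner_diff_left inner_diff_right inner_commute power2_eq_square algebra_simps)
  have "z' - zs = (z - zs) - (inverse \<gamma> * \<alpha>) *\<^sub>R ps_v n y" by (simp add: z')
  then have "\<gamma> * (norm (z' - zs))\<^sup>2 = \<gamma> * ((norm (z - zs))\<^sup>2
      - 2 * (inverse \<gamma> * \<alpha>) * inner (z - zs) (ps_v n y) + (inverse \<gamma> * \<alpha>)\<^sup>2 * (norm (ps_v n y))\<^sup>2)"
    by (simp only: sq)
  also have "\<dots> = \<gamma> * (norm (z - zs))\<^sup>2 - 2 * \<alpha> * inner (z - zs) (ps_v n y)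
      + \<alpha>\<^sup>2 * (inverse \<gamma> * (norm (ps_v n y))\<^sup>2)"
    using assms(1) by (simp add: field_simps power2_eq_square)
  finally have "\<gamma> * (norm (z' - zs))\<^sup>2 = \<gamma> * (norm (z - zs))\<^sup>2
      - 2 * \<alpha> * inner (z - zs) (ps_v n y) + \<alpha>\<^sup>2 * (inverse \<gamma> * (norm (ps_v n y))\<^sup>2)" .
  moreover have "(\<Sum>i=1..<n. (norm (w' i - ws i))\<^sup>2)
      = (\<Sum>i=1..<n. (norm (w i - ws i))\<^sup>2 - 2 * \<alpha> * inner (w i - ws i) (ps_u n x i)
          + \<alpha>\<^sup>2 * (norm (ps_u n x i))\<^sup>2)"
  proof (intro sum.cong refl)
    fix i assume "i \<in> {1..<n}"
    then have "w' i - ws i = (w i - ws i) - \<alpha> *\<^sub>R ps_u n x i" by (simp add: w')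
    then show "(norm (w' i - ws i))\<^sup>2 = (norm (w i - ws i))\<^sup>2
        - 2 * \<alpha> * inner (w i - ws i) (ps_u n x i) + \<alpha>\<^sup>2 * (norm (ps_u n x i))\<^sup>2"
      by (simp only: sq)
  qed
  ultimately show ?thesis
    unfolding prod_norm_sq_diff ps_phi_diff ps_pi_def
    by (simp add: sum_subtractf sum.distrib sum_distrib_left algebra_simps)
qed

text \<open>\<open>ps_pi\<close> is the squared norm of the gradient, and an affine function with
  zero gradient is constant.\<close>

lemma ps_phi_const:
  assumes "\<gamma> > 0" and "ps_pi n \<gamma> x y = 0"
  shows "ps_phi n x y p = ps_phi n x y q"
proof -
  obtain z w z' w' where pq: "p = (z, w)" "q = (z', w')" by (cases p, cases q)
  have "0 \<le> (\<Sum>i=1..<n. (norm (ps_u n x i))\<^sup>2)" "0 \<le> inverse \<gamma> * (norm (ps_v n y))\<^sup>2"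
    using assms(1) by (auto intro: sum_nonneg)
  with assms have *: "(\<Sum>i=1..<n. (norm (ps_u n x i))\<^sup>2) = 0" "inverse \<gamma> * (norm (ps_v n y))\<^sup>2 = 0"
    unfolding ps_pi_def by linarith+
  from *(1) have "\<forall>i\<in>{1..<n}. ps_u n x i = 0" by (simp add: sum_nonneg_eq_0_iff)
  moreover from *(2) assms(1) have "ps_v n y = 0" by simp
  ultimately have "ps_phi n x y (z, w) - ps_phi n x y (z', w') = 0"
    unfolding ps_phi_diff by simp
  then show ?thesis by (simp add: pq)
qed

lemma ps_pi_nonneg: "\<gamma> > 0 \<Longrightarrow> 0 \<le> ps_pi n \<gamma> x y"
  by (simp add: ps_pi_def sum_nonneg)

section \<open>Consequences of strong monotonicity at a solution\<close>

lemma inner_sum_ge_strongly_monotone: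
  fixes T :: "nat \<Rightarrow> 'a::real_inner \<Rightarrow> 'a set"
  assumes "\<And>i. i \<in> {1..n} \<Longrightarrow> monotone_op (T i)"
    and "l \<in> {1..n}" and "strongly_monotone_op \<mu> (T l)"
    and "\<And>i. i \<in> {1..n} \<Longrightarrow> a i \<in> T i (x i)" and "\<And>i. i \<in> {1..n} \<Longrightarrow> b i \<in> T i q"
  shows "\<mu> * (norm (x l - q))\<^sup>2 \<le> (\<Sum>i=1..n. inner (x i - q) (a i - b i))"
proof -
  have "\<mu> * (norm (x l - q))\<^sup>2 \<le> inner (x l - q) (a l - b l)"
    using assms unfolding strongly_monotone_op_def by blast
  \<comment> \<open>Plain monotonicity makes the other summands nonnegative, so the one at
    \<open>l\<close> is a lower bound for the sum.\<close>
  also have "\<dots> \<le> (\<Sum>i=1..n. inner (x i - q) (a i - b i))"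
  proof (rule member_le_sum)
    show "0 \<le> inner (x i - q) (a i - b i)" if "i \<in> {1..n} - {l}" for i
      using assms that unfolding monotone_op_def by blast
  qed (use assms(2) in auto)
  finally show ?thesis .
qed

lemma ps_phi_solution_le:
  assumes "n \<ge> 1"
    and "\<And>i. i \<in> {1..n} \<Longrightarrow> monotone_op (T i)"
    and "l \<in> {1..n}" and "strongly_monotone_op \<mu> (T l)"
    and "\<And>i. i \<in> {1..n} \<Longrightarrow> y i \<in> T i (x i)"
    and "(zs, ws) \<in> extended_solution_set n T"
  shows "ps_phi n x y (zs, ws) \<le> - \<mu> * (norm (x l - zs))\<^sup>2"
proof -
  have "\<mu> * (norm (x l - zs))\<^sup>2 \<le> (\<Sum>i=1..n. inner (x i - zs) (y i - ext_w n ws i))"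
    using inner_sum_ge_strongly_monotone[of n T l \<mu> y x "ext_w n ws" zs] assms
      extended_solution_ext_w[of zs ws n T] by blast
  also have "\<dots> = - ps_phi n x y (zs, ws)"
    unfolding ps_phi_eq_sum[OF assms(1)] sum_negf[symmetric]
    by (intro sum.cong refl) (simp add: inner_diff_left)
  finally show ?thesis by simp
qed

text \<open>Both \<open>q\<close> and \<open>zs\<close> admit selections of the \<open>T i\<close>
  that sum to zero. Pairing their differences with the common vector \<open>q - zs\<close> therefore
  gives zero in total, while strong monotonicity bounds this total below by
  \<open>\<mu> * (norm (q - zs))\<^sup>2\<close>.\<close>

lemma zero_in_sum_iff_solution:
  assumes "n \<ge> 1"
    and "\<And>i. i \<in> {1..n} \<Longrightarrow> monotone_op (T i)"
    and "l \<in> {1..n}" and "\<mu> > 0" and "strongly_monotone_op \<mu> (T l)"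
    and "(zs, ws) \<in> extended_solution_set n T"
  shows "0 \<in> (\<Sum>i=1..n. T i q) \<longleftrightarrow> q = zs"
proof
  assume "0 \<in> (\<Sum>i=1..n. T i q)"
  then obtain s where s: "(\<Sum>i=1..n. s i) = 0" "\<And>i. i \<in> {1..n} \<Longrightarrow> s i \<in> T i q"
    by (auto simp: set_sum_alt)
  have "\<mu> * (norm (q - zs))\<^sup>2 \<le> (\<Sum>i=1..n. inner (q - zs) (s i - ext_w n ws i))"
    using inner_sum_ge_strongly_monotone[of n T l \<mu> s "\<lambda>_. q" "ext_w n ws" zs] assms s(2)
      extended_solution_ext_w[of zs ws n T] by blast
  also have "\<dots> = 0"
    by (simp only: inner_sum_right[symmetric] sum_subtractf s(1) sum_ext_w[OF assms(1)]) simp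
  finally show "q = zs" using assms(4) by (simp add: mult_le_0_iff)
next
  assume "q = zs"
  then have "\<forall>i\<in>{1..n}. ext_w n ws i \<in> T i q"
    using extended_solution_ext_w assms(6) by blast
  then show "0 \<in> (\<Sum>i=1..n. T i q)"
    using sum_ext_w[OF assms(1), of ws] by (subst set_sum_alt) (auto intro!: exI[of _ "ext_w n ws"])
qed

section \<open>Estimates for a single backward or forward step\<close>

lemma backward_step_inner:
  fixes z x w e :: "'a::real_inner"
  assumes "\<rho> > 0" and "y = inverse \<rho> *\<^sub>R (z + \<rho> *\<^sub>R w + e - x)"
    and "inner (z - x) e \<ge> - \<sigma> * (norm (z - x))\<^sup>2"
  shows "(1 - \<sigma>) * inverse \<rho> * (norm (z - x))\<^sup>2 \<le> inner (z - x) (y - w)"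
proof -
  \<comment> \<open>Without the error, the dual residual would be a multiple of the primal one; the
    hypothesis on \<open>inner (z - x) e\<close> limits the loss to the factor
    \<open>1 - \<sigma>\<close>.\<close>
  have "y - w = inverse \<rho> *\<^sub>R ((z - x) + e)"
    using assms(1) by (simp add: assms(2) algebra_simps)
  then have "inner (z - x) (y - w) = inverse \<rho> * ((norm (z - x))\<^sup>2 + inner (z - x) e)"
    by (simp only: inner_scaleR_right inner_add_right power2_norm_eq_inner)
  moreover have "inverse \<rho> * ((1 - \<sigma>) * (norm (z - x))\<^sup>2) \<le> inverse \<rho> * ((norm (z - x))\<^sup>2 + inner (z - x) e)"
    using assms by (intro mult_left_mono) (auto simp: algebra_simps)
  ultimately show ?thesis by (simp add: mult_ac)
qed

lemma backward_step_residual: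
  fixes z x w e :: "'a::real_inner"
  assumes "\<rho> > 0" and "y = inverse \<rho> *\<^sub>R (z + \<rho> *\<^sub>R w + e - x)"
    and "(norm e)\<^sup>2 \<le> \<delta> * (norm (z - x))\<^sup>2"
  shows "(norm (y - w))\<^sup>2 \<le> 2 * (inverse (\<rho>\<^sup>2) * (1 + \<delta>)) * (norm (z - x))\<^sup>2"
proof -
  have "y - w = inverse \<rho> *\<^sub>R ((z - x) + e)"
    using assms(1) by (simp add: assms(2) algebra_simps)
  then have "(norm (y - w))\<^sup>2 = inverse (\<rho>\<^sup>2) * (norm ((z - x) + e))\<^sup>2"
    using assms(1) by (simp add: power_mult_distrib power_inverse)
  also have "\<dots> \<le> inverse (\<rho>\<^sup>2) * (2 * (norm (z - x))\<^sup>2 + 2 * (\<delta> * (norm (z - x))\<^sup>2))"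
    using norm_add_sq_le[of "z - x" e] assms(3) by (intro mult_left_mono) auto
  finally show ?thesis by (simp add: algebra_simps)
qed

text \<open>The update says \<open>F z - w = inverse \<rho> *\<^sub>R (z - x)\<close>. Replacing
  \<open>F z\<close> by \<open>F x\<close> costs at most \<open>L * (norm (z - x))\<^sup>2\<close>,
  by Cauchy-Schwarz and the Lipschitz bound.\<close>

lemma forward_step_inner:
  fixes z x w :: "'a::real_inner"
  assumes "\<rho> > 0" and "x = z - \<rho> *\<^sub>R (F z - w)" and "L-lipschitz_on UNIV F"
  shows "(inverse \<rho> - L) * (norm (z - x))\<^sup>2 \<le> inner (z - x) (F x - w)"
proof -
  have "F x - w = (F x - F z) + inverse \<rho> *\<^sub>R (z - x)"
    using assms(1) by (simp add: assms(2))
  then have eq: "inner (z - x) (F x - w) = inner (z - x) (F x - F z) + inverse \<rho> * (norm (z - x))\<^sup>2"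
    by (simp only: inner_scaleR_right inner_add_right power2_norm_eq_inner)
  have "\<bar>inner (z - x) (F x - F z)\<bar> \<le> norm (z - x) * norm (F x - F z)"
    by (rule Cauchy_Schwarz_ineq2)
  also have "\<dots> \<le> norm (z - x) * (L * norm (z - x))"
    using lipschitz_onD[OF assms(3), of x z]
    by (intro mult_left_mono) (auto simp: dist_norm norm_minus_commute)
  finally show ?thesis unfolding eq by (simp add: algebra_simps power2_eq_square)
qed

lemma forward_step_residual:
  fixes z x w :: "'a::real_inner"
  assumes "\<rho> > 0" and "x = z - \<rho> *\<^sub>R (F z - w)" and "L-lipschitz_on UNIV F"
  shows "(norm (F x - w))\<^sup>2 \<le> 2 * (L\<^sup>2 + inverse (\<rho>\<^sup>2)) * (norm (z - x))\<^sup>2"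
proof -
  have "F x - w = (F x - F z) + inverse \<rho> *\<^sub>R (z - x)"
    using assms(1) by (simp add: assms(2))
  then have "(norm (F x - w))\<^sup>2 \<le> 2 * (norm (F x - F z))\<^sup>2 + 2 * (norm (inverse \<rho> *\<^sub>R (z - x)))\<^sup>2"
    by (simp only: norm_add_sq_le)
  also have "(norm (inverse \<rho> *\<^sub>R (z - x)))\<^sup>2 = inverse (\<rho>\<^sup>2) * (norm (z - x))\<^sup>2"
    using assms(1) by (simp add: power_mult_distrib power_inverse)
  also have "(norm (F x - F z))\<^sup>2 \<le> (L * norm (z - x))\<^sup>2"
    using lipschitz_onD[OF assms(3), of x z]
    by (intro power_mono) (auto simp: dist_norm norm_minus_commute)
  finally show ?thesis by (simp add: power_mult_distrib algebra_simps)
qed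

text \<open>Both parts of the gradient are controlled by residuals: \<open>ps_u\<close> is a
  difference of two primal residuals, and \<open>ps_v\<close> is the sum of the dual residuals,
  since the extended dual variables sum to zero.\<close>

lemma ps_pi_le:
  fixes z :: "'a::real_inner"
  assumes "n \<ge> 1" and "\<gamma> > 0"
    and res: "\<And>i. i \<in> {1..n} \<Longrightarrow> (norm (y i - ext_w n w i))\<^sup>2 \<le> 2 * C * (norm (z - x i))\<^sup>2"
  shows "ps_pi n \<gamma> x y \<le> 2 * real n * (1 + inverse \<gamma> * C) * (\<Sum>i=1..n. (norm (z - x i))\<^sup>2)"
proof -
  let ?s = "\<Sum>i=1..n. (norm (z - x i))\<^sup>2"
  have "(\<Sum>i=1..<n. (norm (ps_u n x i))\<^sup>2) \<le> (\<Sum>i=1..<n. 2 * ?s)"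
  proof (rule sum_mono)
    fix i assume i: "i \<in> {1..<n}"
    have "ps_u n x i = - (z - x i) + (z - x n)" by (simp add: ps_u_def)
    then have "(norm (ps_u n x i))\<^sup>2 \<le> 2 * (norm (z - x i))\<^sup>2 + 2 * (norm (z - x n))\<^sup>2"
      using norm_add_sq_le[of "- (z - x i)" "z - x n"] by (simp add: norm_minus_commute)
    \<comment> \<open>As \<open>i < n\<close>, the two indices are distinct and the pair is a subsum
      of \<open>?s\<close>.\<close>
    also have "\<dots> = 2 * (\<Sum>j\<in>{i, n}. (norm (z - x j))\<^sup>2)" using i by simp
    also have "\<dots> \<le> 2 * ?s"
      using i by (intro mult_left_mono sum_mono2) auto
    finally show "(norm (ps_u n x i))\<^sup>2 \<le> 2 * ?s" .
  qed
  also have "\<dots> \<le> 2 * real n * ?s"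
    by (auto intro!: mult_right_mono sum_nonneg)
  finally have u: "(\<Sum>i=1..<n. (norm (ps_u n x i))\<^sup>2) \<le> 2 * real n * ?s" .
  have "ps_v n y = (\<Sum>i=1..n. y i - ext_w n w i)"
    by (simp only: ps_v_def sum_subtractf sum_ext_w[OF assms(1)] diff_zero)
  then have "(norm (ps_v n y))\<^sup>2 \<le> real n * (\<Sum>i=1..n. (norm (y i - ext_w n w i))\<^sup>2)"
    using norm_sum_sq_le[of "\<lambda>i. y i - ext_w n w i" "{1..n}"] by simp
  also have "\<dots> \<le> real n * (\<Sum>i=1..n. 2 * C * (norm (z - x i))\<^sup>2)"
    by (intro mult_left_mono sum_mono res) auto
  also have "\<dots> = 2 * real n * C * ?s" by (simp add: sum_distrib_left mult_ac)
  finally have "inverse \<gamma> * (norm (ps_v n y))\<^sup>2 \<le> inverse \<gamma> * (2 * real n * C * ?s)"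
    using assms(2) by (intro mult_left_mono) auto
  with u show ?thesis unfolding ps_pi_def by (simp add: algebra_simps)
qed

section \<open>The terminating iteration\<close>

lemma one_in_iters_term_iter: "1 \<in> iters (term_iter n \<gamma> x y)"
proof -
  have "enat 1 \<le> term_iter n \<gamma> x y"
    unfolding term_iter_def by (rule INF_greatest) simp
  then show ?thesis by (simp add: iters_def)
qed

text \<open>A finite infimum excludes the empty set, whose infimum is infinity, and the infimum of a
  nonempty set is attained by well-ordering.\<close>

lemma ps_pi_term_iter:
  assumes "term_iter n \<gamma> x y = enat K"
  shows "1 \<le> K" and "ps_pi n \<gamma> (x K) (y K) = 0"
proof -
  let ?A = "{k. 1 \<le> k \<and> ps_pi n \<gamma> (x k) (y k) = 0}"
  have "?A \<noteq> {}"
  proof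
    assume "?A = {}"
    then have "term_iter n \<gamma> x y = top" unfolding term_iter_def by (simp only: image_empty Inf_empty)
    with assms show False by (simp add: top_enat_def)
  qed
  then obtain k where "enat k \<in> enat ` ?A" by blast
  then have "(INF k\<in>?A. enat k) \<in> enat ` ?A" by (rule wellorder_InfI)
  then have "K \<in> ?A" using assms by (auto simp: term_iter_def)
  then show "1 \<le> K" "ps_pi n \<gamma> (x K) (y K) = 0" by auto
qed

lemma ps_pi_pos_before_term_iter:
  assumes "\<gamma> > 0" and "1 \<le> k" and "enat k < term_iter n \<gamma> x y"
  shows "ps_pi n \<gamma> (x k) (y k) > 0"
proof (rule ccontr)
  assume "\<not> ps_pi n \<gamma> (x k) (y k) > 0"
  then have "ps_pi n \<gamma> (x k) (y k) = 0"
    using ps_pi_nonneg[OF assms(1), of n "x k" "y k"] by linarith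
  then have "term_iter n \<gamma> x y \<le> enat k"
    unfolding term_iter_def using assms(2) by (intro INF_lower) auto
  with assms(3) show False by simp
qed

section \<open>Stepsize bounds and the constant \<open>xi2\<close>\<close>

lemma rho_low_le:
  assumes "\<And>k i. 1 \<le> k \<Longrightarrow> i \<in> {1..n} \<Longrightarrow> \<rho> k i > 0" and "k \<in> iters K" and "i \<in> {1..n}"
  shows "rho_low n K \<rho> \<le> \<rho> k i"
proof -
  have "rho_low n K \<rho> \<le> (INF k\<in>iters K. \<rho> k i)"
    unfolding rho_low_def using assms(3) by (intro Min_le) auto
  \<comment> \<open>A real infimum is a lower bound only for sets that are bounded below; here
    positivity supplies the bound 0.\<close>
  also have "\<dots> \<le> \<rho> k i"
    using assms by (intro cINF_lower bdd_belowI[of _ 0]) (force simp: iters_def)+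
  finally show ?thesis .
qed

lemma rho_up_bound:
  assumes "k \<in> iters K" and "rho_up K \<rho> i < \<infinity>"
  shows "\<rho> k i \<le> real_of_ereal (rho_up K \<rho> i)"
proof -
  have le: "ereal (\<rho> k i) \<le> rho_up K \<rho> i"
    unfolding rho_up_def using assms(1) by (rule SUP_upper)
  \<comment> \<open>\<open>real_of_ereal\<close> sends both infinities to 0: the hypothesis excludes
    the positive one, \<open>le\<close> the negative one.\<close>
  then show ?thesis using assms(2) by (cases "rho_up K \<rho> i") auto
qed

lemma xi2_le_backward:
  assumes "finite IF" and "finite IB" and "i \<in> IB" and "k \<in> iters K" and "rho_up K \<rho> i < \<infinity>"
    and "\<rho> k i > 0" and "\<sigma> < 1"
  shows "xi2 IF IB L \<sigma> K \<rho> \<le> (1 - \<sigma>) * inverse (\<rho> k i)"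
proof -
  have "xi2 IF IB L \<sigma> K \<rho> \<le> (1 - \<sigma>) * inverse (rho_bar IB K \<rho>)"
    unfolding xi2_def using assms by (intro Min_le) auto
  moreover have "real_of_ereal (rho_up K \<rho> i) \<le> rho_bar IB K \<rho>"
    unfolding rho_bar_def using assms by auto
  then have "\<rho> k i \<le> rho_bar IB K \<rho>"
    using rho_up_bound[OF assms(4,5)] by linarith
  then have "(1 - \<sigma>) * inverse (rho_bar IB K \<rho>) \<le> (1 - \<sigma>) * inverse (\<rho> k i)"
    using assms by (intro mult_left_mono le_imp_inverse_le) auto
  ultimately show ?thesis by linarith
qed

lemma xi2_le_forward:
  assumes "finite IF" and "finite IB" and "i \<in> IF" and "k \<in> iters K" and "rho_up K \<rho> i < \<infinity>"
    and "\<rho> k i > 0"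
  shows "xi2 IF IB L \<sigma> K \<rho> \<le> inverse (\<rho> k i) - L i"
proof -
  have "xi2 IF IB L \<sigma> K \<rho> \<le> inverse (real_of_ereal (rho_up K \<rho> i)) - L i"
    unfolding xi2_def using assms by (intro Min_le) auto
  moreover have "inverse (real_of_ereal (rho_up K \<rho> i)) \<le> inverse (\<rho> k i)"
    using assms rho_up_bound[OF assms(4,5)] by (intro le_imp_inverse_le) auto
  ultimately show ?thesis by linarith
qed

lemma xi2_pos:
  assumes "finite IF" and "finite IB" and "IF \<union> IB \<noteq> {}" and "k \<in> iters K"
    and "\<And>i. i \<in> IF \<union> IB \<Longrightarrow> \<rho> k i > 0"
    and "\<And>i. i \<in> IB \<Longrightarrow> rho_up K \<rho> i < \<infinity>"
    and up: "\<And>i. i \<in> IF \<Longrightarrow> rho_up K \<rho> i < 1 / ereal (L i)"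
    and "\<And>i. i \<in> IF \<Longrightarrow> 0 \<le> L i" and "\<sigma> < 1"
  shows "xi2 IF IB L \<sigma> K \<rho> > 0"
proof -
  have "0 < (1 - \<sigma>) * inverse (rho_bar IB K \<rho>)" if ne: "IB \<noteq> {}"
  proof -
    obtain i where i: "i \<in> IB" using ne by auto
    have "0 < real_of_ereal (rho_up K \<rho> i)"
      using rho_up_bound[OF assms(4), of \<rho> i] assms(5,6)[of i] i by fastforce
    also have "\<dots> \<le> rho_bar IB K \<rho>"
      unfolding rho_bar_def using assms(2) i by auto
    finally show ?thesis using assms(9) by simp
  qed
  moreover have "0 < inverse (real_of_ereal (rho_up K \<rho> j)) - L j" if j: "j \<in> IF" for j
  proof -
    have fin: "rho_up K \<rho> j < \<infinity>" using up[OF j] by (rule less_le_trans) simp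
    have pos: "0 < real_of_ereal (rho_up K \<rho> j)"
      using rho_up_bound[OF assms(4) fin] assms(5)[of j] j by fastforce
    then obtain r where r: "rho_up K \<rho> j = ereal r" "0 < r"
      by (cases "rho_up K \<rho> j") auto
    show ?thesis
    \<comment> \<open>For \<open>L j = 0\<close> the quotient \<open>1 / ereal (L j)\<close> is
      infinite and bounds nothing, but then the claim reduces to positivity of the inverse.\<close>
    proof (cases "L j = 0")
      case False
      then have "0 < L j" using assms(8)[OF j] by simp
      then have "r < 1 / L j" using up[OF j] r by (simp add: ereal_divide one_ereal_def)
      then show ?thesis using \<open>0 < L j\<close> r by (simp add: field_simps)
    qed (use pos in simp)
  qed
  ultimately show ?thesis
    unfolding xi2_def using assms(1,3) by (subst Min_gr_iff) auto
qed

text \<open>The choice of \<alpha> gives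
  \<open>\<alpha>\<^sup>2 * \<pi> = \<alpha> * \<beta> * \<phi>\<close>, so the decrease is
  \<open>\<alpha> * ((2 - \<beta>) * \<phi> - 2 * \<psi>)\<close>. The bounds on \<phi> and \<pi>
  keep \<alpha> above \<open>lo * \<xi>2 / \<xi>1\<close>.\<close>

lemma relaxed_projection_descent:
  fixes \<phi> :: real
  assumes "0 < \<xi>1" and "0 < \<xi>2" and "0 \<le> s" and "0 \<le> d" and "0 < lo" and "up < 2"
    and "lo \<le> \<beta>" and "\<beta> \<le> up" and "0 < \<pi>" and "\<pi> \<le> \<xi>1 * s" and "\<xi>2 * s \<le> \<phi>" and "\<psi> \<le> - d"
    and "\<alpha> = \<beta> * \<phi> / \<pi>" and "D' = D - 2 * \<alpha> * (\<phi> - \<psi>) + \<alpha>\<^sup>2 * \<pi>"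
  shows "D' + lo * \<xi>2 / \<xi>1 * ((2 - up) * \<xi>2 * s + 2 * d) \<le> D"
proof -
  have \<phi>: "0 \<le> \<phi>" using assms(2,3,11) by (meson less_imp_le mult_nonneg_nonneg order_trans)
  have "lo * \<xi>2 * \<pi> \<le> lo * \<xi>2 * (\<xi>1 * s)"
    using assms by (intro mult_left_mono) auto
  also have "\<dots> = lo * \<xi>1 * (\<xi>2 * s)" by simp
  also have "\<dots> \<le> lo * \<xi>1 * \<phi>"
    using assms by (intro mult_left_mono) auto
  also have "\<dots> \<le> \<beta> * \<xi>1 * \<phi>"
    using assms \<phi> by (intro mult_right_mono) auto
  finally have \<alpha>: "lo * \<xi>2 / \<xi>1 \<le> \<alpha>"
    using assms(1,9) by (simp add: assms(13) field_simps)
  have "(2 - up) * \<xi>2 * s \<le> (2 - \<beta>) * \<phi>"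
    using assms \<phi> mult_mono[of "2 - up" "2 - \<beta>" "\<xi>2 * s" \<phi>] by simp
  then have "lo * \<xi>2 / \<xi>1 * ((2 - up) * \<xi>2 * s + 2 * d) \<le> \<alpha> * ((2 - \<beta>) * \<phi> - 2 * \<psi>)"
    using assms \<alpha> \<phi> by (intro mult_mono) auto
  moreover have "\<alpha>\<^sup>2 * \<pi> = \<alpha> * \<beta> * \<phi>"
    using assms(9) by (simp add: assms(13) power2_eq_square)
  then have "D' = D - \<alpha> * ((2 - \<beta>) * \<phi> - 2 * \<psi>)"
    by (simp add: assms(14) algebra_simps)
  ultimately show ?thesis by linarith
qed

theorem theorem2:
  fixes T :: "nat \<Rightarrow> 'a::{real_inner, complete_space} \<Rightarrow> 'a set"
    and n l :: nat
    and IF IB :: "nat set"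
    and L \<beta> :: "nat \<Rightarrow> real"
    and \<gamma> \<mu> \<sigma> \<delta> \<beta>lo \<beta>up :: real
    and \<rho> :: "nat \<Rightarrow> nat \<Rightarrow> real"
    and e w x y :: "nat \<Rightarrow> nat \<Rightarrow> 'a"
    and z :: "nat \<Rightarrow> 'a"
    and zs :: 'a and ws :: "nat \<Rightarrow> 'a"
    and Kbar :: enat
  assumes "n \<ge> 1" and "\<gamma> > 0"
    and "operator_assumptions n IF IB L T"
    and "l \<in> {1..n}" and "\<mu> > 0" and "strongly_monotone_op \<mu> (T l)"
    and "\<And>k i. 1 \<le> k \<Longrightarrow> i \<in> {1..n} \<Longrightarrow> \<rho> k i > 0"
    and "0 < \<beta>lo" and "\<beta>lo \<le> \<beta>up" and "\<beta>up < 2"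
    and "\<And>k. 1 \<le> k \<Longrightarrow> \<beta> k \<in> {\<beta>lo..\<beta>up}"
    and "proj_splitting_run n \<gamma> IF IB T \<rho> \<beta> e z w x y"
    and "Kbar = term_iter n \<gamma> x y"
    and "0 \<le> \<sigma>" and "\<sigma> < 1" and "0 \<le> \<delta>"
    and "error_conditions \<sigma> \<delta> IB Kbar \<rho> n e z w x y"
    and "stepsize_conditions n IF IB L Kbar \<rho>"
    and "(zs, ws) \<in> extended_solution_set n T"
  shows "(\<forall>q. 0 \<in> (\<Sum>i=1..n. T i q) \<longleftrightarrow> q = zs) \<and>
    (Kbar = \<infinity> \<longrightarrow> (\<forall>i\<in>{1..n}. (\<lambda>k. x k i) \<longlonglongrightarrow> zs) \<and> z \<longlonglongrightarrow> zs) \<and>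
    (\<forall>K. Kbar = enat K \<longrightarrow> (\<forall>i\<in>{1..n}. x K i = z (Suc K) \<and> z (Suc K) = zs)) \<and>
    (\<forall>k. 1 \<le> k \<and> enat k < Kbar \<longrightarrow>
       (norm ((1 / real k) *\<^sub>R (\<Sum>t=1..k. x t l) - zs))\<^sup>2
         \<le> xi1 n \<gamma> IF L \<delta> Kbar \<rho> * prod_norm_sq n \<gamma> ((z 1, w 1) - (zs, ws))
             / (\<beta>lo * xi2 IF IB L \<sigma> Kbar \<rho> * \<mu> * real k))"
proof -
  note n1 = assms(1) and \<gamma> = assms(2) and ops = assms(3)[unfolded operator_assumptions_def]
    and l = assms(4) and \<mu> = assms(5) and \<rho>pos = assms(7) and sol = assms(19)
    and run = assms(12)[unfolded proj_splitting_run_def assms(13)[symmetric]]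
    and err = assms(17)[unfolded error_conditions_def]
    and steps = assms(18)[unfolded stepsize_conditions_def]
  have mono: "monotone_op (T i)" if "i \<in> {1..n}" for i using ops that by blast
  have sub: "IF \<union> IB = {1..n}" using ops by blast
  then have fin: "finite IF" "finite IB" by (metis finite_Un finite_atLeastAtMost)+
  have \<rho>F: "\<rho> k i > 0" if "1 \<le> k" "i \<in> IF" for k i using \<rho>pos sub that by blast
  have \<rho>B: "\<rho> k i > 0" if "1 \<le> k" "i \<in> IB" for k i using \<rho>pos sub that by blast
  have upB: "rho_up Kbar \<rho> i < \<infinity>" if "i \<in> IB" for i using steps that by blast
  have upF: "rho_up Kbar \<rho> i < \<infinity>" if "i \<in> IF" for i
    using steps that by (meson less_le_trans ereal_less_eq(1))
  have lip: "(L i)-lipschitz_on UNIV (\<lambda>z. the_elem (T i z))" if "i \<in> IF" for i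
    using ops that by blast
  have single: "the_elem (T i q) \<in> T i q" if "i \<in> IF" for i q
    using ops that by (metis is_singleton_the_elem insertI1)
  define r where "r = rho_low n Kbar \<rho>"
  have r: "r > 0" using steps by (simp add: r_def)
  have r_le: "inverse ((\<rho> k i)\<^sup>2) \<le> inverse (r\<^sup>2)" if "k \<in> iters Kbar" "i \<in> {1..n}" for k i
    using rho_low_le[OF \<rho>pos that] r
    by (auto simp: r_def intro!: le_imp_inverse_le power_mono)
  \<comment> \<open>A residual constant common to forward and backward steps; it is the bracket
    inside \<open>xi1\<close>.\<close>
  define C where "C = (L_bar IF L)\<^sup>2 * real (card IF) + inverse (r\<^sup>2) * (1 + \<delta>)"
  define \<xi>1 where "\<xi>1 = xi1 n \<gamma> IF L \<delta> Kbar \<rho>"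
  define \<xi>2 where "\<xi>2 = xi2 IF IB L \<sigma> Kbar \<rho>"
  define s where "s k = (\<Sum>i=1..n. (norm (z k - x k i))\<^sup>2)" for k
  define d where "d k = (norm (x k l - zs))\<^sup>2" for k
  define D where "D k = prod_norm_sq n \<gamma> ((z k, w k) - (zs, ws))" for k
  have C: "C \<ge> 0" using assms(16) by (simp add: C_def)
  have \<xi>1_eq: "\<xi>1 = 2 * real n * (1 + 2 * inverse \<gamma> * C)"
    by (simp add: \<xi>1_def xi1_def C_def r_def)
  then have \<xi>1: "\<xi>1 > 0" using n1 \<gamma> C by (auto intro!: mult_pos_pos add_pos_nonneg)
  have s_nonneg: "0 \<le> s k" for k by (simp add: s_def sum_nonneg)
  have d_nonneg: "0 \<le> d k" for k by (simp add: d_def)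
  have \<xi>2: "\<xi>2 > 0"
    unfolding \<xi>2_def
  \<comment> \<open>Iteration 1 is carried out whatever the value of \<open>Kbar\<close>.\<close>
  proof (rule xi2_pos[where k = 1])
    show "1 \<in> iters Kbar" unfolding assms(13) by (rule one_in_iters_term_iter)
    show "IF \<union> IB \<noteq> {}" using sub n1 by simp
    show "\<rho> 1 i > 0" if "i \<in> IF \<union> IB" for i using that \<rho>pos sub by blast
    show "0 \<le> L i" if "i \<in> IF" for i using lip[OF that] by (rule lipschitz_on_nonneg)
    show "rho_up Kbar \<rho> i < 1 / ereal (L i)" if "i \<in> IF" for i using steps that by blast
  qed (use fin upB assms(15) in auto)

  \<comment> \<open>Bounds on \<open>ps_phi\<close> and \<open>ps_pi\<close> at each
    iteration\<close>
  have step: "y k i \<in> T i (x k i) \<and>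
      \<xi>2 * (norm (z k - x k i))\<^sup>2 \<le> inner (z k - x k i) (y k i - ext_w n (w k) i) \<and>
      (norm (y k i - ext_w n (w k) i))\<^sup>2 \<le> 2 * C * (norm (z k - x k i))\<^sup>2"
    if k: "k \<in> iters Kbar" and i: "i \<in> {1..n}" for k i
  proof -
    have k1: "1 \<le> k" using k by (simp add: iters_def)
    show ?thesis
    proof (cases "i \<in> IB")
      case True
      let ?a = "z k + \<rho> k i *\<^sub>R ext_w n (w k) i + e k i"
      have px: "x k i \<in> prox (\<rho> k i) (T i) ?a" and y: "y k i = inverse (\<rho> k i) *\<^sub>R (?a - x k i)"
        using run k True by (auto simp: Let_def)
      have er: "inner (z k - x k i) (e k i) \<ge> - \<sigma> * (norm (z k - x k i))\<^sup>2"
        "(norm (e k i))\<^sup>2 \<le> \<delta> * (norm (z k - x k i))\<^sup>2"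
        using err k True by blast+
      \<comment> \<open>The resolvent equation determines its operator value, which is thus the
        computed \<open>y k i\<close>.\<close>
      obtain y' where "y' \<in> T i (x k i)" "x k i + \<rho> k i *\<^sub>R y' = ?a"
        using px by (auto simp: prox_def)
      moreover from this(2) have "?a - x k i = \<rho> k i *\<^sub>R y'" by (metis add_diff_cancel_left')
      then have "y k i = y'" using y \<rho>B[OF k1 True] by simp
      ultimately have mem: "y k i \<in> T i (x k i)" by simp
      have "\<xi>2 \<le> (1 - \<sigma>) * inverse (\<rho> k i)"
        unfolding \<xi>2_def using fin True k upB \<rho>B[OF k1 True] assms(15) by (intro xi2_le_backward) auto
      then have "\<xi>2 * (norm (z k - x k i))\<^sup>2 \<le> (1 - \<sigma>) * inverse (\<rho> k i) * (norm (z k - x k i))\<^sup>2"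
        by (rule mult_right_mono) simp
      also have "\<dots> \<le> inner (z k - x k i) (y k i - ext_w n (w k) i)"
        by (rule backward_step_inner[OF \<rho>B[OF k1 True] y er(1)])
      finally have inn: "\<xi>2 * (norm (z k - x k i))\<^sup>2 \<le> inner (z k - x k i) (y k i - ext_w n (w k) i)" .
      have "inverse ((\<rho> k i)\<^sup>2) * (1 + \<delta>) \<le> inverse (r\<^sup>2) * (1 + \<delta>)"
        using r_le[OF k i] assms(16) by (intro mult_right_mono) auto
      also have "\<dots> \<le> C" by (simp add: C_def)
      finally have "2 * (inverse ((\<rho> k i)\<^sup>2) * (1 + \<delta>)) * (norm (z k - x k i))\<^sup>2
          \<le> 2 * C * (norm (z k - x k i))\<^sup>2"
        by (intro mult_right_mono) auto
      with backward_step_residual[OF \<rho>B[OF k1 True] y er(2)] mem inn show ?thesis by linarith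
    next
      case False
      then have F: "i \<in> IF" using sub i by blast
      let ?F = "\<lambda>q. the_elem (T i q)"
      have x: "x k i = z k - \<rho> k i *\<^sub>R (?F (z k) - ext_w n (w k) i)" and y: "y k i = ?F (x k i)"
        using run k F by auto
      have mem: "y k i \<in> T i (x k i)" using single[OF F] y by simp
      have "\<xi>2 \<le> inverse (\<rho> k i) - L i"
        unfolding \<xi>2_def using fin F k upF \<rho>F[OF k1 F] by (intro xi2_le_forward) auto
      then have "\<xi>2 * (norm (z k - x k i))\<^sup>2 \<le> (inverse (\<rho> k i) - L i) * (norm (z k - x k i))\<^sup>2"
        by (rule mult_right_mono) simp
      also have "\<dots> \<le> inner (z k - x k i) (y k i - ext_w n (w k) i)"
        unfolding y by (rule forward_step_inner[OF \<rho>F[OF k1 F] x lip[OF F]])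
      finally have inn: "\<xi>2 * (norm (z k - x k i))\<^sup>2 \<le> inner (z k - x k i) (y k i - ext_w n (w k) i)" .
      have "L i \<le> L_bar IF L" using F fin by (auto simp: L_bar_def)
      then have "(L i)\<^sup>2 \<le> (L_bar IF L)\<^sup>2"
        using lipschitz_on_nonneg[OF lip[OF F]] by (rule power_mono)
      \<comment> \<open>The set \<open>IF\<close> contains \<open>i\<close>, so the factor
        \<open>card IF\<close> is at least 1.\<close>
      also have "\<dots> \<le> (L_bar IF L)\<^sup>2 * real (card IF)"
        using F fin card_gt_0_iff[of IF] by (intro mult_le_cancel_left1[THEN iffD2]) auto
      finally have "(L i)\<^sup>2 \<le> (L_bar IF L)\<^sup>2 * real (card IF)" .
      moreover have "inverse (r\<^sup>2) * 1 \<le> inverse (r\<^sup>2) * (1 + \<delta>)"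
        using assms(16) by (intro mult_left_mono) auto
      then have "inverse ((\<rho> k i)\<^sup>2) \<le> inverse (r\<^sup>2) * (1 + \<delta>)"
        using r_le[OF k i] by linarith
      ultimately have "(L i)\<^sup>2 + inverse ((\<rho> k i)\<^sup>2) \<le> C" by (simp add: C_def)
      then have "2 * ((L i)\<^sup>2 + inverse ((\<rho> k i)\<^sup>2)) * (norm (z k - x k i))\<^sup>2
          \<le> 2 * C * (norm (z k - x k i))\<^sup>2"
        by (intro mult_right_mono) auto
      with forward_step_residual[OF \<rho>F[OF k1 F] x lip[OF F]] mem inn show ?thesis
        unfolding y by linarith
    qed
  qed
  have \<phi>_ge: "\<xi>2 * s k \<le> ps_phi n (x k) (y k) (z k, w k)" if "k \<in> iters Kbar" for k
    unfolding ps_phi_eq_sum[OF n1] s_def sum_distrib_left using step[OF that] by (intro sum_mono) blast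
  have \<phi>_sol: "ps_phi n (x k) (y k) (zs, ws) \<le> - (\<mu> * d k)" if "k \<in> iters Kbar" for k
    using ps_phi_solution_le[OF n1 mono l assms(6) _ sol, of "y k" "x k"] step[OF that]
    by (simp add: d_def)
  have \<pi>_le: "ps_pi n \<gamma> (x k) (y k) \<le> \<xi>1 * s k" if "k \<in> iters Kbar" for k
  proof -
    have "ps_pi n \<gamma> (x k) (y k) \<le> 2 * real n * (1 + inverse \<gamma> * C) * s k"
      unfolding s_def using step[OF that] by (intro ps_pi_le[where w = "w k"] n1 \<gamma>) blast
    also have "\<dots> \<le> \<xi>1 * s k"
      unfolding \<xi>1_eq using \<gamma> C s_nonneg by (intro mult_right_mono mult_left_mono) auto
    finally show ?thesis .
  qed

  \<comment> \<open>Descent of the squared distance to the solution and its telescoped sum\<close>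
  define c where "c = \<beta>lo * \<xi>2 / \<xi>1"
  have c: "c > 0" using assms(8) \<xi>1 \<xi>2 by (simp add: c_def)
  \<comment> \<open>The index stays strictly below \<open>Kbar\<close>, because the terminating
    iteration does not perform the projection update.\<close>
  have descent: "D (Suc k) + c * ((2 - \<beta>up) * \<xi>2 * s k + 2 * (\<mu> * d k)) \<le> D k"
    if k: "1 \<le> k" "enat k < Kbar" for k
  proof -
    have it: "k \<in> iters Kbar" using k by (simp add: iters_def)
    have \<pi>: "ps_pi n \<gamma> (x k) (y k) > 0"
      using ps_pi_pos_before_term_iter[OF \<gamma>] k assms(13) by blast
    define \<alpha> where "\<alpha> = \<beta> k * ps_phi n (x k) (y k) (z k, w k) / ps_pi n \<gamma> (x k) (y k)"
    have upd: "z (Suc k) = z k - (inverse \<gamma> * \<alpha>) *\<^sub>R ps_v n (y k)"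
      "\<And>i. i \<in> {1..<n} \<Longrightarrow> w (Suc k) i = w k i - \<alpha> *\<^sub>R ps_u n (x k) i"
      using run it \<pi> by (auto simp: Let_def \<alpha>_def)
    show ?thesis
      unfolding c_def
    proof (rule relaxed_projection_descent[OF \<xi>1 \<xi>2 s_nonneg _ assms(8) assms(10) _ _ \<pi>
          \<pi>_le[OF it] \<phi>_ge[OF it] \<phi>_sol[OF it] \<alpha>_def])
      show "D (Suc k) = D k
          - 2 * \<alpha> * (ps_phi n (x k) (y k) (z k, w k) - ps_phi n (x k) (y k) (zs, ws))
          + \<alpha>\<^sup>2 * ps_pi n \<gamma> (x k) (y k)"
        unfolding D_def by (rule projection_step[OF \<gamma> upd])
    qed (use assms(11)[OF k(1)] \<mu> d_nonneg in auto)
  qed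
  have D_nonneg: "0 \<le> D k" for k
    using \<gamma> by (simp add: D_def prod_norm_sq_def sum_nonneg)
  have total: "(\<Sum>t=1..k. c * ((2 - \<beta>up) * \<xi>2 * s t + 2 * (\<mu> * d t))) \<le> D 1"
    if "enat k < Kbar" for k
  proof -
    \<comment> \<open>Keeping \<open>D (Suc k)\<close> on the left lets the induction
      telescope.\<close>
    have "D (Suc k) + (\<Sum>t=1..k. c * ((2 - \<beta>up) * \<xi>2 * s t + 2 * (\<mu> * d t))) \<le> D 1"
      using that
    proof (induction k)
      case (Suc k)
      have "enat k < enat (Suc k)" by simp
      with Suc.prems have "enat k < Kbar" by (rule less_trans[rotated])
      with Suc.IH descent[of "Suc k"] Suc.prems show ?case by simp
    qed simp
    with D_nonneg[of "Suc k"] show ?thesis by linarith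
  qed

  \<comment> \<open>Strong convergence of an infinite run\<close>
  have "(\<forall>i\<in>{1..n}. (\<lambda>k. x k i) \<longlonglongrightarrow> zs) \<and> z \<longlonglongrightarrow> zs" if inf: "Kbar = \<infinity>"
  proof -
    let ?f = "\<lambda>t. c * ((2 - \<beta>up) * \<xi>2 * s t + 2 * (\<mu> * d t))"
    have f_nonneg: "0 \<le> ?f t" for t
      using c assms(10) \<xi>2 \<mu> s_nonneg d_nonneg by simp
    \<comment> \<open>The shift is due to iterations starting at 1: the descent bound says nothing
      about index 0.\<close>
    have "summable (\<lambda>t. ?f (Suc t))"
    proof (rule summableI_nonneg_bounded[OF f_nonneg])
      fix k
      have "(\<Sum>t<k. ?f (Suc t)) = (\<Sum>t=1..k. ?f t)"
        by (rule sum.reindex_bij_witness[of _ "\<lambda>t. t - 1" Suc]) auto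
      then show "(\<Sum>t<k. ?f (Suc t)) \<le> D 1" using total[of k] inf by simp
    qed
    then have "(\<lambda>t. ?f (Suc t)) \<longlonglongrightarrow> 0" by (rule summable_LIMSEQ_zero)
    then have f0: "?f \<longlonglongrightarrow> 0" by (rule LIMSEQ_imp_Suc)
    have "s \<longlonglongrightarrow> 0"
    proof (rule tendsto_sandwich[OF _ _ tendsto_const])
      show "(\<lambda>k. ?f k / (c * (2 - \<beta>up) * \<xi>2)) \<longlonglongrightarrow> 0"
        using tendsto_divide[OF f0 tendsto_const, of "c * (2 - \<beta>up) * \<xi>2"] c assms(10) \<xi>2 by simp
      show "\<forall>\<^sub>F k in sequentially. s k \<le> ?f k / (c * (2 - \<beta>up) * \<xi>2)"
        using c assms(10) \<xi>2 \<mu> d_nonneg by (auto simp: field_simps)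
    qed (simp add: s_nonneg)
    have "d \<longlonglongrightarrow> 0"
    proof (rule tendsto_sandwich[OF _ _ tendsto_const])
      show "(\<lambda>k. ?f k / (2 * c * \<mu>)) \<longlonglongrightarrow> 0"
        using tendsto_divide[OF f0 tendsto_const, of "2 * c * \<mu>"] c \<mu> by simp
      show "\<forall>\<^sub>F k in sequentially. d k \<le> ?f k / (2 * c * \<mu>)"
      proof (intro always_eventually allI)
        fix k
        have "0 \<le> c * ((2 - \<beta>up) * \<xi>2 * s k)" using c assms(10) \<xi>2 s_nonneg by simp
        then have "d k * (2 * c * \<mu>) \<le> ?f k" by (simp add: algebra_simps)
        then show "d k \<le> ?f k / (2 * c * \<mu>)" using c \<mu> by (subst pos_le_divide_eq) auto
      qed
    qed (simp add: d_nonneg)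
    have zx: "(\<lambda>k. z k - x k i) \<longlonglongrightarrow> 0" if i: "i \<in> {1..n}" for i
    proof -
      have "(\<lambda>k. (norm (z k - x k i))\<^sup>2) \<longlonglongrightarrow> 0"
      proof (rule tendsto_sandwich[OF _ _ tendsto_const \<open>s \<longlonglongrightarrow> 0\<close>])
        show "\<forall>\<^sub>F k in sequentially. (norm (z k - x k i))\<^sup>2 \<le> s k"
          unfolding s_def using i by (intro always_eventually allI member_le_sum) auto
      qed simp
      then show ?thesis by (simp add: tendsto_norm_zero_iff)
    qed
    have xl: "(\<lambda>k. x k l - zs) \<longlonglongrightarrow> 0"
      using \<open>d \<longlonglongrightarrow> 0\<close> by (simp add: d_def[abs_def] tendsto_norm_zero_iff)
    \<comment> \<open>Splits \<open>z k\<close> as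
      \<open>(z k - x k l) + (x k l - zs) + zs\<close>.\<close>
    have z: "z \<longlonglongrightarrow> zs"
      using tendsto_add[OF tendsto_add[OF zx[OF l] xl] tendsto_const[of zs]] by simp
    have "(\<lambda>k. x k i) \<longlonglongrightarrow> zs" if "i \<in> {1..n}" for i
      using tendsto_diff[OF z zx[OF that]] by simp
    with z show ?thesis by blast
  qed

  \<comment> \<open>Exactness at finite termination\<close>
  moreover have "\<forall>i\<in>{1..n}. x K i = z (Suc K) \<and> z (Suc K) = zs" if K: "Kbar = enat K" for K
  proof -
    have it: "K \<in> iters Kbar" and \<pi>: "ps_pi n \<gamma> (x K) (y K) = 0"
      using ps_pi_term_iter[of n \<gamma> x y K] K assms(13) by (auto simp: iters_def)
    have "\<xi>2 * s K + \<mu> * d K \<le> 0"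
      using \<phi>_ge[OF it] \<phi>_sol[OF it] ps_phi_const[OF \<gamma> \<pi>, of "(z K, w K)" "(zs, ws)"] by linarith
    moreover have "0 \<le> \<xi>2 * s K" "0 \<le> \<mu> * d K" using \<xi>2 \<mu> s_nonneg d_nonneg by auto
    ultimately have "\<xi>2 * s K = 0" "\<mu> * d K = 0" by linarith+
    then have "s K = 0" "d K = 0" using \<xi>2 \<mu> by auto
    then have "\<forall>i\<in>{1..n}. x K i = z K" "x K l = zs"
      by (auto simp: s_def d_def sum_nonneg_eq_0_iff)
    \<comment> \<open>All \<open>x K i\<close> coincide with \<open>z K\<close>, and the index
      \<open>l\<close> identifies this common point.\<close>
    then have "\<forall>i\<in>{1..n}. x K i = zs" using l by auto
    moreover have "z (Suc K) = x K n" using run it \<pi> by auto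
    ultimately show ?thesis using n1 by auto
  qed

  \<comment> \<open>The ergodic convergence rate\<close>
  moreover have "(norm ((1 / real k) *\<^sub>R (\<Sum>t=1..k. x t l) - zs))\<^sup>2
      \<le> \<xi>1 * D 1 / (\<beta>lo * \<xi>2 * \<mu> * real k)" if k: "1 \<le> k" "enat k < Kbar" for k
  proof -
    have "(1 / real k) *\<^sub>R (\<Sum>t=1..k. x t l) - zs = (1 / real k) *\<^sub>R (\<Sum>t=1..k. x t l - zs)"
      using k(1) by (simp add: sum_subtractf scaleR_diff_right sum_constant_scaleR del: One_nat_def)
    then have "(norm ((1 / real k) *\<^sub>R (\<Sum>t=1..k. x t l) - zs))\<^sup>2
        = (norm (\<Sum>t=1..k. x t l - zs))\<^sup>2 / (real k)\<^sup>2"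
      by (simp add: power_divide)
    also have "\<dots> \<le> (real k * (\<Sum>t=1..k. d t)) / (real k)\<^sup>2"
      using norm_sum_sq_le[of "\<lambda>t. x t l - zs" "{1..k}"] by (intro divide_right_mono) (auto simp: d_def)
    also have "\<dots> = (\<Sum>t=1..k. d t) / real k" by (simp add: power2_eq_square)
    also have "\<dots> \<le> D 1 / (c * \<mu>) / real k"
    proof (intro divide_right_mono)
      \<comment> \<open>Discards the nonnegative \<open>s\<close> term and one of the two copies of
        \<open>\<mu> * d t\<close>; dividing by \<open>c * \<mu>\<close> then produces the constant
        of the rate.\<close>
      have "c * \<mu> * (\<Sum>t=1..k. d t) \<le> (\<Sum>t=1..k. c * ((2 - \<beta>up) * \<xi>2 * s t + 2 * (\<mu> * d t)))"
        unfolding sum_distrib_left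
      proof (rule sum_mono)
        fix t
        have "\<mu> * d t \<le> (2 - \<beta>up) * \<xi>2 * s t + 2 * (\<mu> * d t)"
          using assms(10) \<xi>2 \<mu> s_nonneg[of t] d_nonneg[of t] by simp
        then show "c * \<mu> * d t \<le> c * ((2 - \<beta>up) * \<xi>2 * s t + 2 * (\<mu> * d t))"
          using c mult_left_mono[of "\<mu> * d t" _ c] by (simp add: mult.assoc)
      qed
      also have "\<dots> \<le> D 1" by (rule total[OF k(2)])
      finally show "(\<Sum>t=1..k. d t) \<le> D 1 / (c * \<mu>)"
        using c \<mu> by (simp add: pos_le_divide_eq mult.commute)
    qed simp
    also have "\<dots> = \<xi>1 * D 1 / (\<beta>lo * \<xi>2 * \<mu> * real k)"
      using \<xi>1 by (simp add: c_def field_simps)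
    finally show ?thesis .
  qed
  ultimately show ?thesis
    using zero_in_sum_iff_solution[OF n1 mono l \<mu> assms(6) sol]
    unfolding \<xi>1_def \<xi>2_def D_def by blast
qed

end
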